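(* There exist an absolute constant $c>0$ and a function $\varepsilon:\{3,4,5,\dots\}\to\mathbb{R}$ with $\varepsilon(k)\to 0$ as $k\to\infty$ such that the following holds. For every integer $k\ge 3$, all positive integers $m_1,\dots,m_k$ and all integers $a_1,\dots,a_k$ such that the residue classes $a_1 \pmod{m_1},\dots,a_k\pmod{m_k}$ are pairwise disjoint, $$\max_{1\le i<j\le k}\gcd(m_i,m_j)\ \ge\ c\,k\exp\!\left(-(2+\varepsilon(k))\sqrt{\frac{\log k}{\log\log k}}\right).$$
   Context: The residue class $a\pmod m$ is the set $\{n\in\mathbb{Z}: n\equiv a \pmod m\}$. The moduli are not assumed to be distinct or bounded. The claim spells out the asymptotic estimate $\max_{i<j}\gcd(m_i,m_j)\gg k\exp(-(2+o(1))\sqrt{\log k/\log\log k})$, where $o(1)\to0$ as $k\to\infty$ and both the implied constant and the $o(1)$ depend on nothing other than $k$. *)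

theory Defs
  imports Complex_Main "HOL-Library.Disjoint_Sets" "HOL-Number_Theory.Cong"
begin

definition residue_class :: "int \<Rightarrow> nat \<Rightarrow> int set" where
  "residue_class a m = {n. [n = a] (mod int m)}"

end

theory Submission
  imports Defs "HOL-Real_Asymp.Real_Asymp"
begin

text \<open>
  Let \<open>D\<close> be the largest gcd of two moduli. The stronger bound \<open>k \<le> C D (log D)\<^sup>5\<close> is proved,
  so the theorem holds with \<open>\<epsilon> = 0\<close>. An integer \<open>T > D\<close> divides at most one modulus, and every
  estimate below comes from that remark together with a weighted count. Fix \<open>\<Lambda>\<close> with
  \<open>D < 2 ^ \<Lambda>\<close>.

  Call a prime \<open>p\<close> critical for \<open>m\<close> if multiplying some divisor \<open>d \<le> D\<close> of \<open>m\<close> by \<open>p\<close> gives a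
  divisor of \<open>m\<close> that exceeds \<open>D\<close>. The largest divisor of \<open>m\<close> without critical primes, its free
  part \<open>c\<close>, can be multiplied to any divisor \<open>d \<le> D\<close> coprime to it without leaving the range up
  to \<open>D\<close>. In particular \<open>c \<le> D\<close>.

  Two kinds of classes are counted directly. Those whose modulus has a divisor in
  \<open>(D, 2 \<Lambda>\<^sup>4 D]\<close> are at most \<open>2 \<Lambda>\<^sup>4 D\<close> in number; for all others the critical primes exceed
  \<open>2 \<Lambda>\<^sup>4\<close>. Those for which \<open>1 / sqrt p\<close> sums to more than 1 over the primes \<open>p\<close> in
  \<open>(2 \<Lambda>\<^sup>4, D]\<close> that divide the modulus have many prime divisors in some interval \<open>[Y, 2 Y)\<close>;
  comparing the number of their \<open>r\<close>-element subsets, where \<open>Y ^ (r - 1) \<le> D < Y ^ r\<close>, with the number of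
  all \<open>r\<close>-element subsets of \<open>[Y, 2 Y)\<close> bounds these classes by \<open>\<Lambda>\<^sup>5 D\<close> (\<open>dense_bound\<close>).

  For the remaining classes fix the size of the free part up to a factor 2, say \<open>c \<ge> M\<close>, and an
  integer \<open>x\<close>, and consider the classes with \<open>x \<equiv> a (mod c)\<close>. Any two of them agree on the free
  parts, so their disjointness comes from a prime that is critical for at least one of the two.
  With \<open>E = D / M\<close>, each prime is critical for at most \<open>E\<close> of these classes, and the
  product of a set of primes critical for two of them is at most \<open>E\<close>. A branching argument on
  common critical primes, in which a prime \<open>p\<close> costs \<open>sqrt p\<close>, then shows that there are
  \<open>O(\<Lambda>\<^sup>2 E)\<close> of them (\<open>branching_bound\<close>, \<open>fibre_bound\<close>). Averaging over \<open>x\<close> bounds the number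
  of classes of the given free part size by \<open>O(\<Lambda>\<^sup>2 D)\<close>, and there are at most \<open>\<Lambda>\<close> sizes.
\<close>

section \<open>Critical primes and the free part of a modulus\<close>

text \<open>The primes that carry some divisor of \<open>n\<close> across the threshold \<open>D\<close> in one step.\<close>
definition critical_primes :: "nat \<Rightarrow> nat \<Rightarrow> nat set" where
  "critical_primes D n = {p. prime p \<and> (\<exists>d. d * p dvd n \<and> d \<le> D \<and> D < d * p)}"

text \<open>
  The largest divisor of \<open>n\<close> without critical primes. It contains every noncritical prime to its full
  power in \<open>n\<close>, so it is coprime to its cofactor. Divisors without critical primes are closed under
  least common multiples, hence the encoding as an \<open>Lcm\<close>.
\<close>
definition free_part :: "nat \<Rightarrow> nat \<Rightarrow> nat" where
  "free_part D n = Lcm {g. g dvd n \<and> (\<forall>p. prime p \<longrightarrow> p dvd g \<longrightarrow> p \<notin> critical_primes D n)}"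

lemma critical_primesD:
  assumes "p \<in> critical_primes D n"
  shows "prime p" "p dvd n"
  using assms by (auto simp: critical_primes_def dest: dvd_mult_right)

text \<open>
  Divisors up to \<open>D\<close> absorb noncritical primes: the factor \<open>f\<close> is attached prime by prime, and no step
  can cross the threshold.
\<close>
lemma mult_noncritical_le:
  assumes "0 < n" "e * f dvd n" "e \<le> D"
    and "\<And>p. prime p \<Longrightarrow> p dvd f \<Longrightarrow> p \<notin> critical_primes D n"
  shows "e * f \<le> D"
  using assms(2,4)
proof (induction f rule: less_induct)
  case (less f)
  have "f \<noteq> 0" using less.prems(1) \<open>0 < n\<close> by auto
  show ?case
  proof (cases "f = 1")
    case True
    then show ?thesis using \<open>e \<le> D\<close> by simp
  next
    case False
    then obtain p where p: "prime p" "p dvd f" using prime_factor_nat by blast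
    then obtain f' where f: "f = p * f'" by blast
    have "f' < f" using f \<open>f \<noteq> 0\<close> prime_gt_1_nat[OF p(1)] by simp
    moreover have "e * f' dvd n" using less.prems(1) f
      by (metis dvd_mult_left mult.assoc mult.commute)
    ultimately have "e * f' \<le> D" using less.IH less.prems(2) f by (meson dvd_mult)
    moreover have "(e * f') * p dvd n" using less.prems(1) f by (simp add: ac_simps)
    moreover have "p \<notin> critical_primes D n" using less.prems(2) p by blast
    ultimately have "(e * f') * p \<le> D" using p(1) by (auto simp: critical_primes_def not_less)
    then show ?thesis using f by (simp add: ac_simps)
  qed
qed

lemma free_part_dvd: "free_part D n dvd n"
  unfolding free_part_def by (rule Lcm_least) simp

lemma dvd_free_part:
  assumes "g dvd n" "\<And>p. prime p \<Longrightarrow> p dvd g \<Longrightarrow> p \<notin> critical_primes D n"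
  shows "g dvd free_part D n"
  unfolding free_part_def using assms by (intro dvd_Lcm) auto

lemma free_part_pos: "0 < n \<Longrightarrow> 0 < free_part D n"
  using free_part_dvd dvd_pos_nat by blast

lemma prime_dvd_free_part_noncritical:
  assumes "0 < n" "prime p" "p dvd free_part D n"
  shows "p \<notin> critical_primes D n"
proof -
  define A where "A = {g. g dvd n \<and> (\<forall>p. prime p \<longrightarrow> p dvd g \<longrightarrow> p \<notin> critical_primes D n)}"
  have "finite A" unfolding A_def using \<open>0 < n\<close> by (auto intro: finite_subset[OF _ finite_divisors_nat])
  then have "Lcm A dvd \<Prod>A" by (intro Lcm_least) auto
  then have "p dvd \<Prod>A" using assms(3) unfolding free_part_def A_def by (rule dvd_trans[rotated])
  then obtain g where "g \<in> A" "p dvd g"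
    using prime_dvd_prod_iff[OF \<open>finite A\<close> assms(2), of "\<lambda>x. x"] by auto
  then show ?thesis using assms(2) unfolding A_def by auto
qed

text \<open>A product of critical primes is coprime to the free part and so absorbs it.\<close>
lemma mult_free_part_le:
  assumes "0 < n" "d dvd n" "d \<le> D" "\<And>p. prime p \<Longrightarrow> p dvd d \<Longrightarrow> p \<in> critical_primes D n"
  shows "d * free_part D n \<le> D"
proof (rule mult_noncritical_le[OF assms(1) _ assms(3)])
  have "coprime d (free_part D n)"
  proof (rule ccontr)
    assume "\<not> coprime d (free_part D n)"
    then have "gcd d (free_part D n) \<noteq> 1" by (simp add: coprime_iff_gcd_eq_1)
    then obtain p where p: "prime p" "p dvd gcd d (free_part D n)" using prime_factor_nat by blast
    then have "p dvd d" "p dvd free_part D n" by simp_all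
    then show False using assms(4) prime_dvd_free_part_noncritical[OF assms(1)] p(1) by blast
  qed
  then show "d * free_part D n dvd n" using assms(2) free_part_dvd by (simp add: divides_mult)
qed (use assms(1) prime_dvd_free_part_noncritical in blast)

lemma free_part_le: "0 < n \<Longrightarrow> 0 < D \<Longrightarrow> free_part D n \<le> D"
  using mult_free_part_le[of n 1 D] by auto

lemma factor_by_prime_predicate:
  fixes n :: nat
  assumes "0 < n"
  shows "\<exists>u v. n = u * v \<and> (\<forall>p. prime p \<longrightarrow> p dvd u \<longrightarrow> Q p) \<and> (\<forall>p. prime p \<longrightarrow> p dvd v \<longrightarrow> \<not> Q p)"
  using assms
proof (induction n rule: less_induct)
  case (less n)
  show ?case
  proof (cases "n = 1")
    case True
    then show ?thesis by (intro exI[of _ 1]) auto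
  next
    case False
    then obtain p where p: "prime p" "p dvd n" using prime_factor_nat by blast
    then obtain n' where n: "n = p * n'" by blast
    have "n' < n" "0 < n'" using n less.prems prime_gt_1_nat[OF p(1)] by auto
    then obtain u v where uv: "n' = u * v" "\<forall>p. prime p \<longrightarrow> p dvd u \<longrightarrow> Q p"
      "\<forall>p. prime p \<longrightarrow> p dvd v \<longrightarrow> \<not> Q p" using less.IH by blast
    have pd: "q = p \<or> q dvd w" if "prime q" "q dvd p * w" for q w
      using that p(1) prime_dvd_mult_iff primes_dvd_imp_eq by blast
    show ?thesis
    proof (cases "Q p")
      case True
      then have "\<forall>q. prime q \<longrightarrow> q dvd p * u \<longrightarrow> Q q" using pd[of _ u] uv(2) by auto
      moreover have "n = (p * u) * v" using n uv(1) by (simp add: mult.assoc)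
      ultimately show ?thesis using uv(3) by (intro exI[of _ "p * u"] exI[of _ v] conjI)
    next
      case False
      then have "\<forall>q. prime q \<longrightarrow> q dvd p * v \<longrightarrow> \<not> Q q" using pd[of _ v] uv(3) by auto
      moreover have "n = u * (p * v)" using n uv(1) by (simp add: mult.left_commute)
      ultimately show ?thesis using uv(2) by (intro exI[of _ u] exI[of _ "p * v"] conjI)
    qed
  qed
qed

text \<open>
  The witness \<open>d\<close> of a critical prime can be chosen coprime to the free part, and then it is small:
  \<open>d \<le> D / free_part D n\<close>. This is what makes each prime critical for few classes.
\<close>
lemma critical_prime_witness:
  assumes "0 < n" "p \<in> critical_primes D n"
  shows "\<exists>d. d * free_part D n \<le> D \<and> d * p dvd n \<and> D < d * p"
proof -
  from assms(2) obtain d where d: "prime p" "d * p dvd n" "d \<le> D" "D < d * p"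
    unfolding critical_primes_def by blast
  have "0 < d" using d(4) by (cases d) auto
  obtain u v where uv: "d = u * v" "\<forall>q. prime q \<longrightarrow> q dvd u \<longrightarrow> q \<in> critical_primes D n"
      "\<forall>q. prime q \<longrightarrow> q dvd v \<longrightarrow> q \<notin> critical_primes D n"
    using factor_by_prime_predicate[OF \<open>0 < d\<close>, of "\<lambda>q. q \<in> critical_primes D n"] by blast
  have "0 < v" "0 < u" using \<open>0 < d\<close> uv(1) by auto
  have upv: "(u * p) * v dvd n" using d(2) uv(1) by (simp add: ac_simps)
  \<comment> \<open>If \<open>u * p\<close> were at most \<open>D\<close>, it would absorb the noncritical part \<open>v\<close> of \<open>d\<close>.\<close>
  have "D < u * p"
  proof (rule ccontr)
    assume "\<not> D < u * p"
    then have "(u * p) * v \<le> D" using upv uv(3) by (intro mult_noncritical_le[OF assms(1), of "u * p" v]) auto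
    then show False using d(4) uv(1) by (simp add: ac_simps)
  qed
  moreover have "u * p dvd n" using upv by (rule dvd_mult_left)
  moreover have "u * free_part D n \<le> D"
  proof (rule mult_free_part_le[OF assms(1)])
    show "u dvd n" using \<open>u * p dvd n\<close> by (rule dvd_mult_left)
    have "u \<le> u * v" using \<open>0 < v\<close> by simp
    then show "u \<le> D" using d(3) uv(1) by linarith
  qed (use uv in blast)
  ultimately show ?thesis by blast
qed

lemma prod_primes_dvd:
  fixes m :: nat
  assumes "finite P" "\<And>p. p \<in> P \<Longrightarrow> prime p \<and> p dvd m"
  shows "\<Prod>P dvd m"
  using assms
proof (induction P rule: finite_induct)
  case (insert p P)
  have "coprime p (\<Prod>P)"
    using insert by (intro prod_coprime_right) (auto intro!: primes_coprime)
  then show ?case using insert by (auto intro!: divides_mult)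
qed simp

section \<open>The branching argument\<close>

text \<open>
  Here \<open>N i\<close> stands for the critical primes of class \<open>i\<close>. For a set \<open>P\<close> of primes let \<open>S P\<close> be the
  set of classes \<open>j\<close> with \<open>P \<subseteq> N j\<close>. Pick a class \<open>i\<close> with \<open>N i\<close> disjoint from \<open>P\<close> that shares a
  prime with nearly all members of \<open>S P\<close>; such a prime is new, so \<open>S P\<close> is nearly covered by the
  sets \<open>S (insert p P)\<close> for \<open>p \<in> N i\<close>. Since the weights \<open>1 / sqrt p\<close> sum to at most 1 over \<open>N i\<close>,
  this yields \<open>card (S P) \<le> O(1) * E / sqrt (\<Prod>P)\<close>, starting from the sets \<open>P\<close> with
  \<open>\<Prod>P > E\<close>, for which \<open>S P\<close> has at most one element.
\<close>
lemma branching_bound: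
  fixes N :: "'a \<Rightarrow> nat set" and E :: real and \<Lambda> :: nat
  assumes fin: "finite G" and L1: "1 \<le> \<Lambda>" and E1: "1 \<le> E" and EL: "E < 2 ^ \<Lambda>"
    and finN: "\<And>i. i \<in> G \<Longrightarrow> finite (N i)"
    and N2: "\<And>i p. i \<in> G \<Longrightarrow> p \<in> N i \<Longrightarrow> 2 \<le> p \<and> real p \<le> E"
    and wt: "\<And>i. i \<in> G \<Longrightarrow> (\<Sum>p\<in>N i. 1 / sqrt (real p)) \<le> 1"
    and few: "\<And>p. real (card {j\<in>G. p \<in> N j}) \<le> E"
    and face: "\<And>i j P. i \<in> G \<Longrightarrow> j \<in> G \<Longrightarrow> i \<noteq> j \<Longrightarrow> P \<subseteq> N i \<Longrightarrow> P \<subseteq> N j \<Longrightarrow> real (\<Prod>P) \<le> E"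
    and bad: "\<And>j. j \<in> G \<Longrightarrow> real (card {i\<in>G. i = j \<or> N i \<inter> N j = {}}) \<le> 6 * real \<Lambda> * E"
  shows "real (card G) \<le> 24 * (real \<Lambda>)\<^sup>2 * E"
proof (rule ccontr)
  assume "\<not> ?thesis"
  then have big: "24 * (real \<Lambda>)\<^sup>2 * E < card G" by simp
  define S where "S P = {j\<in>G. P \<subseteq> N j}" for P
  have finS: "finite (S P)" for P unfolding S_def using fin by simp
  have LL: "real \<Lambda> \<le> (real \<Lambda>)\<^sup>2" using L1 by (simp add: power2_eq_square)
  have step: "\<exists>i\<in>G. N i \<inter> P = {} \<and>
      (1 - 1 / (2 * \<Lambda>)) * card (S P) \<le> (\<Sum>p\<in>N i. real (card (S (insert p P))))"
    if P: "finite P" "real (\<Prod>P) \<le> E" "S P \<noteq> {}" for P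
  proof -
    obtain j0 where "j0 \<in> G" "P \<subseteq> N j0" using P(3) unfolding S_def by auto
    then have P2: "p \<in> P \<Longrightarrow> 2 \<le> p" for p using N2 by blast
    \<comment> \<open>At least half of all classes have no critical prime in \<open>P\<close>, since \<open>P\<close> is small.\<close>
    have "2 ^ card P \<le> \<Prod>P" using prod_mono[of P "\<lambda>_. 2" "\<lambda>p. p"] P2 by simp
    then have "(2::real) ^ card P \<le> real (\<Prod>P)" by (metis of_nat_le_iff of_nat_numeral of_nat_power)
    then have "(2::real) ^ card P < 2 ^ \<Lambda>" using P(2) EL by linarith
    then have cP: "card P < \<Lambda>" using power_less_imp_less_exp by fastforce
    define H where "H = {i\<in>G. N i \<inter> P = {}}"
    have sub: "H \<subseteq> G" unfolding H_def by auto
    have finH: "finite H" using sub fin finite_subset by blast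
    have "G - H \<subseteq> (\<Union>p\<in>P. {j\<in>G. p \<in> N j})" unfolding H_def by auto
    then have "card (G - H) \<le> card (\<Union>p\<in>P. {j\<in>G. p \<in> N j})"
      using P(1) fin by (intro card_mono) auto
    also have "\<dots> \<le> (\<Sum>p\<in>P. card {j\<in>G. p \<in> N j})"
      by (rule card_UN_le[OF P(1)])
    finally have "card (G - H) \<le> (\<Sum>p\<in>P. card {j\<in>G. p \<in> N j})" .
    then have "real (card (G - H)) \<le> (\<Sum>p\<in>P. real (card {j\<in>G. p \<in> N j}))"
      by (simp flip: of_nat_sum)
    also have "\<dots> \<le> (\<Sum>p\<in>P. E)" using few by (intro sum_mono) auto
    also have "\<dots> \<le> real \<Lambda> * E" using cP E1 by (simp add: mult_right_mono)
    also have "\<dots> \<le> (real \<Lambda>)\<^sup>2 * E" using LL E1 by (intro mult_right_mono) auto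
    finally have "real (card (G - H)) \<le> real (card G) / 2" using big by linarith
    moreover have "card G = card H + card (G - H)"
      using card_Diff_subset[OF finH sub] card_mono[OF fin sub] by linarith
    ultimately have cH: "real (card G) / 2 \<le> card H" by simp
    \<comment> \<open>On average over \<open>H\<close>, only a small part of \<open>S P\<close> shares no prime with \<open>i\<close>.\<close>
    define B where "B i = {j\<in>S P. i = j \<or> N i \<inter> N j = {}}" for i
    have "(\<Sum>i\<in>H. card (B i)) = (\<Sum>i\<in>H. \<Sum>j\<in>{j\<in>S P. i = j \<or> N i \<inter> N j = {}}. 1)" unfolding B_def by simp
    also have "\<dots> = (\<Sum>j\<in>S P. \<Sum>i\<in>{i\<in>H. i = j \<or> N i \<inter> N j = {}}. 1)"
      by (rule sum.swap_restrict[OF finH finS])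
    also have "\<dots> = (\<Sum>j\<in>S P. card {i\<in>H. i = j \<or> N i \<inter> N j = {}})" by simp
    finally have "real (\<Sum>i\<in>H. card (B i)) = (\<Sum>j\<in>S P. real (card {i\<in>H. i = j \<or> N i \<inter> N j = {}}))" by simp
    also have "\<dots> \<le> (\<Sum>j\<in>S P. 6 * real \<Lambda> * E)"
    proof (rule sum_mono)
      fix j assume "j \<in> S P"
      then have "j \<in> G" unfolding S_def by auto
      have "card {i\<in>H. i = j \<or> N i \<inter> N j = {}} \<le> card {i\<in>G. i = j \<or> N i \<inter> N j = {}}"
        using sub fin by (intro card_mono) auto
      then show "real (card {i\<in>H. i = j \<or> N i \<inter> N j = {}}) \<le> 6 * real \<Lambda> * E"
        using bad[OF \<open>j \<in> G\<close>] by linarith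
    qed
    finally have tot: "(\<Sum>i\<in>H. real (card (B i))) \<le> 6 * real \<Lambda> * E * card (S P)" by (simp add: mult.commute)
    have "\<exists>i\<in>H. real (card (B i)) \<le> card (S P) / (2 * \<Lambda>)"
    proof (rule ccontr)
      assume "\<not> ?thesis"
      then have gt: "\<forall>i\<in>H. card (S P) / (2 * \<Lambda>) \<le> real (card (B i))" by auto
      have "card H * (card (S P) / (2 * \<Lambda>)) \<le> (\<Sum>i\<in>H. real (card (B i)))"
        using sum_mono[of H "\<lambda>_. card (S P) / (2 * real \<Lambda>)" "\<lambda>i. real (card (B i))"] gt by simp
      then have "card H * (card (S P) / (2 * \<Lambda>)) \<le> 6 * real \<Lambda> * E * card (S P)" using tot by linarith
      moreover have "0 < card (S P)" using P(3) finS by (simp add: card_gt_0_iff)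
      ultimately have "card H \<le> 12 * (real \<Lambda>)\<^sup>2 * E" using L1
        by (simp add: field_simps power2_eq_square)
      then show False using cH big by linarith
    qed
    then obtain i where i: "i \<in> H" "real (card (B i)) \<le> card (S P) / (2 * \<Lambda>)" by blast
    then have iG: "i \<in> G" and iP: "N i \<inter> P = {}" unfolding H_def by auto
    have "S P \<subseteq> B i \<union> (\<Union>p\<in>N i. S (insert p P))" unfolding B_def S_def by auto
    then have "card (S P) \<le> card (B i \<union> (\<Union>p\<in>N i. S (insert p P)))"
      using finS finN[OF iG] unfolding B_def by (intro card_mono) auto
    also have "\<dots> \<le> card (B i) + (\<Sum>p\<in>N i. card (S (insert p P)))"
      using card_Un_le[of "B i" "\<Union>p\<in>N i. S (insert p P)"] card_UN_le[OF finN[OF iG], of "\<lambda>p. S (insert p P)"]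
      by linarith
    finally have "real (card (S P)) \<le> card (B i) + (\<Sum>p\<in>N i. real (card (S (insert p P))))"
      by (simp flip: of_nat_sum of_nat_add)
    then have "(1 - 1 / (2 * \<Lambda>)) * card (S P) \<le> (\<Sum>p\<in>N i. real (card (S (insert p P))))"
      using i(2) by (simp add: algebra_simps)
    then show ?thesis using iG iP by blast
  qed
  have main: "real (card (S P)) \<le> (1 + 1 / \<Lambda>) ^ r * (E / sqrt (real (\<Prod>P)))"
    if "finite P" "real (\<Prod>P) \<le> E" "E < real (\<Prod>P) * 2 ^ r" for P r
    using that
  proof (induction r arbitrary: P)
    case 0
    then show ?case by simp
  next
    case (Suc r)
    show ?case
    proof (cases "S P = {}")
      case True
      have "0 \<le> (1 + 1 / real \<Lambda>) ^ Suc r * (E / sqrt (real (\<Prod>P)))"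
        using E1 by (intro mult_nonneg_nonneg divide_nonneg_nonneg) (auto intro: prod_nonneg)
      then show ?thesis using True by simp
    next
      case False
      obtain i where i: "i \<in> G" "N i \<inter> P = {}"
        "(1 - 1 / (2 * \<Lambda>)) * card (S P) \<le> (\<Sum>p\<in>N i. real (card (S (insert p P))))"
        using step[OF Suc.prems(1,2) False] by blast
      have "\<Prod>P \<noteq> 0" using Suc.prems(3) E1 by (intro notI) simp
      then have pos: "0 < real (\<Prod>P)" by (subst of_nat_0_less_iff) simp
      define c where "c = (1 + 1 / real \<Lambda>) ^ r"
      have c1: "1 \<le> c" unfolding c_def by simp
      \<comment> \<open>Once the product exceeds \<open>E\<close>, it is still at most \<open>E\<^sup>2\<close>, because the last prime added is
        at most \<open>E\<close>. So the claimed bound is at least 1 there.\<close>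
      have each: "real (card (S (insert p P))) \<le> c * (E / sqrt (real (\<Prod>P))) * (1 / sqrt p)" if p: "p \<in> N i" for p
      proof -
        have pp: "2 \<le> p" "real p \<le> E" "p \<notin> P" using N2[OF i(1) p] i(2) p by auto
        have pr: "\<Prod>(insert p P) = p * \<Prod>P" using pp(3) Suc.prems(1) by simp
        have "real (card (S (insert p P))) \<le> c * (E / sqrt (real (\<Prod>(insert p P))))"
        proof (cases "real (\<Prod>(insert p P)) \<le> E")
          case True
          have "E < real (\<Prod>P) * 2 ^ r * 2" using Suc.prems(3) by simp
          also have "\<dots> \<le> real (\<Prod>P) * 2 ^ r * p" using pp(1) pos by (intro mult_left_mono) auto
          finally show ?thesis unfolding c_def using True Suc.prems(1) pr by (intro Suc.IH) (auto simp: ac_simps)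
        next
          case False
          have "card (S (insert p P)) \<le> 1"
          proof (rule ccontr)
            assume "\<not> ?thesis"
            then obtain x y where "x \<in> S (insert p P)" "y \<in> S (insert p P)" "x \<noteq> y"
              using card_le_Suc0_iff_eq[OF finS, of "insert p P"] by auto
            then show False using face[of x y "insert p P"] False unfolding S_def by auto
          qed
          moreover have "real (\<Prod>(insert p P)) \<le> E\<^sup>2"
            using pr Suc.prems(2) pp(2) pos by (simp add: power2_eq_square mult_mono)
          then have "sqrt (real (\<Prod>(insert p P))) \<le> E" using E1 by (intro real_le_lsqrt) auto
          then have "1 \<le> E / sqrt (real (\<Prod>(insert p P)))" using pr pos pp(1) by simp
          then have "1 * 1 \<le> c * (E / sqrt (real (\<Prod>(insert p P))))" using c1 by (intro mult_mono) auto
          ultimately show ?thesis by linarith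
        qed
        then show ?thesis using pr by (simp add: real_sqrt_mult mult.commute)
      qed
      have "(1 - 1 / (2 * \<Lambda>)) * card (S P) \<le> (\<Sum>p\<in>N i. c * (E / sqrt (real (\<Prod>P))) * (1 / sqrt p))"
        by (rule order_trans[OF i(3)]) (intro sum_mono each)
      also have "\<dots> = c * (E / sqrt (real (\<Prod>P))) * (\<Sum>p\<in>N i. 1 / sqrt p)" by (simp add: sum_distrib_left)
      also have "\<dots> \<le> c * (E / sqrt (real (\<Prod>P))) * 1"
        using wt[OF i(1)] c1 E1 by (intro mult_left_mono mult_nonneg_nonneg divide_nonneg_nonneg) (auto intro: prod_nonneg)
      finally have le: "(1 - 1 / (2 * \<Lambda>)) * card (S P) \<le> c * (E / sqrt (real (\<Prod>P)))" by simp
      have "1 \<le> (1 + 1 / real \<Lambda>) * (1 - 1 / (2 * \<Lambda>))" using L1 by (simp add: field_simps)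
      then have "1 * real (card (S P)) \<le> (1 + 1 / real \<Lambda>) * (1 - 1 / (2 * \<Lambda>)) * card (S P)"
        by (intro mult_right_mono) auto
      also have "\<dots> = (1 + 1 / real \<Lambda>) * ((1 - 1 / (2 * \<Lambda>)) * card (S P))" by simp
      also have "\<dots> \<le> (1 + 1 / real \<Lambda>) * (c * (E / sqrt (real (\<Prod>P))))"
        using le by (intro mult_left_mono) auto
      finally show ?thesis unfolding c_def by (simp add: mult.assoc)
    qed
  qed
  have "real (card G) \<le> (1 + 1 / \<Lambda>) ^ \<Lambda> * E" using main[of "{}" \<Lambda>] E1 EL unfolding S_def by simp
  also have "(1 + 1 / real \<Lambda>) ^ \<Lambda> \<le> exp 1"
  proof -
    have "(1 + 1 / real \<Lambda>) ^ \<Lambda> \<le> exp (1 / real \<Lambda>) ^ \<Lambda>" by (intro power_mono exp_ge_add_one_self) auto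
    also have "\<dots> = exp 1" using L1 by (simp flip: exp_of_nat_mult)
    finally show ?thesis .
  qed
  then have "(1 + 1 / real \<Lambda>) ^ \<Lambda> * E \<le> 3 * E" using exp_le E1 by (intro mult_right_mono) auto
  finally have "card G \<le> 3 * E" by simp
  moreover have "24 * 1 * E \<le> 24 * (real \<Lambda>)\<^sup>2 * E" using L1 E1 by (intro mult_mono) auto
  ultimately show False using big E1 by linarith
qed

text \<open>
  Two classes may fail to share a critical prime if a critical prime of one is a noncritical prime of
  the other; \<open>C i\<close> stands for the noncritical primes of \<open>i\<close>. As \<open>C i\<close> is small, this happens for few
  pairs, and the classes with many such partners can be discarded.
\<close>
lemma branching_bound_weak:
  fixes N C :: "'a \<Rightarrow> nat set" and E :: real and \<Lambda> :: nat
  assumes fin: "finite G" and L1: "1 \<le> \<Lambda>" and E1: "1 \<le> E" and EL: "E < 2 ^ \<Lambda>"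
    and finN: "\<And>i. i \<in> G \<Longrightarrow> finite (N i)"
    and N2: "\<And>i p. i \<in> G \<Longrightarrow> p \<in> N i \<Longrightarrow> 2 \<le> p \<and> real p \<le> E"
    and wt: "\<And>i. i \<in> G \<Longrightarrow> (\<Sum>p\<in>N i. 1 / sqrt (real p)) \<le> 1"
    and few: "\<And>p. real (card {j\<in>G. p \<in> N j}) \<le> E"
    and face: "\<And>i j P. i \<in> G \<Longrightarrow> j \<in> G \<Longrightarrow> i \<noteq> j \<Longrightarrow> P \<subseteq> N i \<Longrightarrow> P \<subseteq> N j \<Longrightarrow> real (\<Prod>P) \<le> E"
    and finC: "\<And>i. i \<in> G \<Longrightarrow> finite (C i) \<and> card (C i) \<le> \<Lambda>"
    and pair: "\<And>i j. i \<in> G \<Longrightarrow> j \<in> G \<Longrightarrow> i \<noteq> j \<Longrightarrow> N i \<inter> N j \<noteq> {} \<or> N i \<inter> C j \<noteq> {} \<or> C i \<inter> N j \<noteq> {}"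
  shows "real (card G) \<le> 48 * (real \<Lambda>)\<^sup>2 * E"
proof -
  define B where "B j = {i\<in>G. i = j \<or> N i \<inter> N j = {}}" for j
  have LE: "1 \<le> real \<Lambda> * E" using mult_mono[of 1 "real \<Lambda>" 1 E] L1 E1 by simp
  have one: "real (card {i\<in>G. N i \<inter> C j \<noteq> {}}) \<le> real \<Lambda> * E" if "j \<in> G" for j
  proof -
    have "card {i\<in>G. N i \<inter> C j \<noteq> {}} \<le> card (\<Union>p\<in>C j. {i\<in>G. p \<in> N i})"
      using fin finC[OF that] by (intro card_mono) auto
    also have "\<dots> \<le> (\<Sum>p\<in>C j. card {i\<in>G. p \<in> N i})" using finC[OF that] by (intro card_UN_le) auto
    finally have "real (card {i\<in>G. N i \<inter> C j \<noteq> {}}) \<le> (\<Sum>p\<in>C j. real (card {i\<in>G. p \<in> N i}))"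
      by (simp flip: of_nat_sum)
    also have "\<dots> \<le> (\<Sum>p\<in>C j. E)" using few by (intro sum_mono) auto
    also have "\<dots> \<le> real \<Lambda> * E" using finC[OF that] E1 by (simp add: mult_right_mono)
    finally show ?thesis .
  qed
  have "real (card (B j)) \<le> 1 + (real (card {i\<in>G. N i \<inter> C j \<noteq> {}}) + real (card {i\<in>G. N j \<inter> C i \<noteq> {}}))"
    if "j \<in> G" for j
  proof -
    have "B j \<subseteq> {j} \<union> ({i\<in>G. N i \<inter> C j \<noteq> {}} \<union> {i\<in>G. N j \<inter> C i \<noteq> {}})"
      unfolding B_def using pair[OF _ that] by blast
    then have "card (B j) \<le> card ({j} \<union> ({i\<in>G. N i \<inter> C j \<noteq> {}} \<union> {i\<in>G. N j \<inter> C i \<noteq> {}}))"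
      using fin by (intro card_mono) auto
    also have "\<dots> \<le> 1 + (card {i\<in>G. N i \<inter> C j \<noteq> {}} + card {i\<in>G. N j \<inter> C i \<noteq> {}})"
      using card_Un_le[of "{j}" "{i\<in>G. N i \<inter> C j \<noteq> {}} \<union> {i\<in>G. N j \<inter> C i \<noteq> {}}"]
        card_Un_le[of "{i\<in>G. N i \<inter> C j \<noteq> {}}" "{i\<in>G. N j \<inter> C i \<noteq> {}}"] by simp
    finally show ?thesis by linarith
  qed
  then have "(\<Sum>j\<in>G. real (card (B j))) \<le>
      (\<Sum>j\<in>G. 1 + (real (card {i\<in>G. N i \<inter> C j \<noteq> {}}) + real (card {i\<in>G. N j \<inter> C i \<noteq> {}})))"
    by (rule sum_mono)
  also have "\<dots> = card G + ((\<Sum>j\<in>G. real (card {i\<in>G. N i \<inter> C j \<noteq> {}})) + (\<Sum>j\<in>G. real (card {i\<in>G. N j \<inter> C i \<noteq> {}})))"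
    by (simp add: sum.distrib)
  also have "(\<Sum>j\<in>G. real (card {i\<in>G. N j \<inter> C i \<noteq> {}})) = (\<Sum>j\<in>G. real (card {i\<in>G. N i \<inter> C j \<noteq> {}}))"
    using sum.swap_restrict[OF fin fin, of "\<lambda>_ _. 1::real" "\<lambda>j i. N j \<inter> C i \<noteq> {}"] by simp
  also have "(\<Sum>j\<in>G. real (card {i\<in>G. N i \<inter> C j \<noteq> {}})) \<le> (\<Sum>j\<in>G. real \<Lambda> * E)"
    using one by (intro sum_mono) auto
  finally have "(\<Sum>j\<in>G. real (card (B j))) \<le> card G + 2 * (card G * (real \<Lambda> * E))" by (simp add: mult_ac)
  also have "\<dots> \<le> card G * (real \<Lambda> * E) + 2 * (card G * (real \<Lambda> * E))"
    using mult_left_mono[OF LE, of "real (card G)"] by (simp add: mult_ac)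
  finally have tot: "(\<Sum>j\<in>G. real (card (B j))) \<le> 3 * (real \<Lambda> * E) * card G" by (simp add: mult_ac)
  define G' where "G' = {j\<in>G. real (card (B j)) \<le> 6 * real \<Lambda> * E}"
  have sub: "G' \<subseteq> G" unfolding G'_def by auto
  then have finG': "finite G'" using fin finite_subset by blast
  have "card (G - G') * (6 * (real \<Lambda> * E)) = (\<Sum>j\<in>G - G'. 6 * (real \<Lambda> * E))" by simp
  also have "\<dots> \<le> (\<Sum>j\<in>G - G'. real (card (B j)))"
    by (rule sum_mono) (auto simp: G'_def mult.assoc)
  also have "\<dots> \<le> (\<Sum>j\<in>G. real (card (B j)))" using fin by (intro sum_mono2) auto
  finally have "(2 * card (G - G')) * (3 * (real \<Lambda> * E)) \<le> card G * (3 * (real \<Lambda> * E))" using tot by (simp add: mult_ac)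
  then have "real (2 * card (G - G')) \<le> card G" using LE by (subst (asm) mult_le_cancel_right) auto
  moreover have "card G = card G' + card (G - G')"
    using card_Diff_subset[OF finG' sub] card_mono[OF fin sub] by linarith
  ultimately have half: "real (card G) \<le> 2 * card G'" by simp
  have "real (card G') \<le> 24 * (real \<Lambda>)\<^sup>2 * E"
  proof (rule branching_bound[where N = N, OF finG' L1 E1 EL])
    fix p show "real (card {j\<in>G'. p \<in> N j}) \<le> E"
      using few[of p] card_mono[of "{j\<in>G. p \<in> N j}" "{j\<in>G'. p \<in> N j}"] fin sub by fastforce
  next
    fix j assume "j \<in> G'"
    have "card {i\<in>G'. i = j \<or> N i \<inter> N j = {}} \<le> card (B j)"
      unfolding B_def using fin sub by (intro card_mono) auto
    then show "real (card {i\<in>G'. i = j \<or> N i \<inter> N j = {}}) \<le> 6 * real \<Lambda> * E"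
      using \<open>j \<in> G'\<close> unfolding G'_def by simp
  qed (use sub finN N2 wt face in blast)+
  then show ?thesis using half by simp
qed

section \<open>Classes whose free parts are compatible\<close>

text \<open>
  If all classes contain \<open>x\<close> modulo their free parts, then two of them can only be separated by a
  prime that is critical for one of them.
\<close>
lemma fibre_bound:
  fixes m :: "'a \<Rightarrow> nat" and a :: "'a \<Rightarrow> int" and x :: int
  assumes fin: "finite G" and pos: "\<And>i. i \<in> G \<Longrightarrow> 0 < m i"
    and gcd_le: "\<And>i j. i \<in> G \<Longrightarrow> j \<in> G \<Longrightarrow> i \<noteq> j \<Longrightarrow> gcd (m i) (m j) \<le> D"
    and ncong: "\<And>i j. i \<in> G \<Longrightarrow> j \<in> G \<Longrightarrow> i \<noteq> j \<Longrightarrow> \<not> [a i = a j] (mod int (gcd (m i) (m j)))"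
    and x: "\<And>i. i \<in> G \<Longrightarrow> [x = a i] (mod int (free_part D (m i)))"
    and M: "\<And>i. i \<in> G \<Longrightarrow> M \<le> free_part D (m i)" "0 < M"
    and D: "0 < D" "D < 2 ^ \<Lambda>"
    and wt: "\<And>i. i \<in> G \<Longrightarrow> (\<Sum>p | p \<in> critical_primes D (m i) \<and> p \<le> D. 1 / sqrt (real p)) \<le> 1"
  shows "real (card G) \<le> 48 * (real \<Lambda>)\<^sup>2 * (real D / real M)"
proof (cases "G = {}")
  case True
  then show ?thesis by simp
next
  case False
  then obtain i0 where "i0 \<in> G" by blast
  have "M \<le> D" using M(1)[OF \<open>i0 \<in> G\<close>] free_part_le[OF pos[OF \<open>i0 \<in> G\<close>] D(1)] by linarith
  define E where "E = real D / real M"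
  have leE: "real d \<le> E" if "d * free_part D (m i) \<le> D" "i \<in> G" for d i
  proof -
    have "d * M \<le> D" using that M(1)[OF that(2)] by (meson le_trans mult_le_mono2)
    then have "real d * real M \<le> real D" by (simp flip: of_nat_mult)
    then show ?thesis unfolding E_def using M(2) by (simp add: pos_le_divide_eq)
  qed
  have "1 \<le> E" unfolding E_def using \<open>M \<le> D\<close> M(2) by simp
  have "E \<le> D" unfolding E_def using M(2) mult_left_mono[of 1 "real M" "real D"] by (simp add: divide_le_eq)
  moreover have "real D < 2 ^ \<Lambda>" using D(2) by (metis of_nat_less_iff of_nat_numeral of_nat_power)
  ultimately have "E < 2 ^ \<Lambda>" by linarith
  have "1 \<le> \<Lambda>" using D by (cases \<Lambda>) auto
  define N where "N i = {p \<in> critical_primes D (m i). real p \<le> E}" for i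
  define C where "C i = {p. prime p \<and> p dvd free_part D (m i)}" for i
  have finN: "finite (N i)" for i
    by (rule finite_subset[of _ "{..D}"]) (use \<open>E \<le> D\<close> in \<open>auto simp: N_def\<close>)
  have inN: "p \<in> N i" if "i \<in> G" "p \<in> critical_primes D (m i)" "p \<le> D" for i p
  proof -
    have "p * free_part D (m i) \<le> D"
      using critical_primesD[OF that(2)] that primes_dvd_imp_eq
      by (intro mult_free_part_le[OF pos[OF that(1)]]) auto
    then show ?thesis using leE that unfolding N_def by blast
  qed
  have "real (card G) \<le> 48 * (real \<Lambda>)\<^sup>2 * E"
  proof (rule branching_bound_weak[where N = N and C = C, OF fin \<open>1 \<le> \<Lambda>\<close> \<open>1 \<le> E\<close> \<open>E < 2 ^ \<Lambda>\<close>])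
    fix i assume i: "i \<in> G"
    show "finite (N i)" by (rule finN)
    show "2 \<le> p \<and> real p \<le> E" if "p \<in> N i" for p
      using that critical_primesD(1)[THEN prime_ge_2_nat] unfolding N_def by blast
    have "(\<Sum>p\<in>N i. 1 / sqrt (real p)) \<le> (\<Sum>p | p \<in> critical_primes D (m i) \<and> p \<le> D. 1 / sqrt (real p))"
      using \<open>E \<le> D\<close> unfolding N_def by (intro sum_mono2) auto
    then show "(\<Sum>p\<in>N i. 1 / sqrt (real p)) \<le> 1" using wt[OF i] by linarith
    have "finite (C i)"
      by (rule finite_subset[of _ "{..free_part D (m i)}"])
        (use dvd_imp_le free_part_pos[OF pos[OF i]] in \<open>auto simp: C_def\<close>)
    moreover have "\<Prod>(C i) dvd free_part D (m i)"
      using \<open>finite (C i)\<close> by (rule prod_primes_dvd) (auto simp: C_def)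
    then have "\<Prod>(C i) \<le> free_part D (m i)" using free_part_pos[OF pos[OF i]] by (rule dvd_imp_le)
    then have "\<Prod>(C i) < 2 ^ \<Lambda>" using free_part_le[OF pos[OF i] D(1)] D(2) by linarith
    moreover have "2 ^ card (C i) \<le> \<Prod>(C i)"
      using prod_mono[of "C i" "\<lambda>_. 2" "\<lambda>p. p"] prime_ge_2_nat by (auto simp: C_def)
    ultimately show "finite (C i) \<and> card (C i) \<le> \<Lambda>"
      using power_less_imp_less_exp[of "2::nat" "card (C i)" \<Lambda>] by linarith
  next
    fix p
    \<comment> \<open>The witness \<open>w j\<close> is at most \<open>E\<close>, and \<open>w j * p > D\<close> divides no modulus but \<open>m j\<close>.\<close>
    define W where "W = {j\<in>G. p \<in> N j}"
    have "\<forall>j\<in>W. \<exists>d. d * free_part D (m j) \<le> D \<and> d * p dvd m j \<and> D < d * p"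
      unfolding W_def N_def using critical_prime_witness pos by blast
    then obtain w where w: "\<And>j. j \<in> W \<Longrightarrow> w j * free_part D (m j) \<le> D \<and> w j * p dvd m j \<and> D < w j * p"
      by metis
    have "inj_on w W"
    proof (rule inj_onI, rule ccontr)
      fix i j assume ij: "i \<in> W" "j \<in> W" "w i = w j" "i \<noteq> j"
      then have G: "i \<in> G" "j \<in> G" unfolding W_def by auto
      have "w i * p dvd gcd (m i) (m j)" using w[OF ij(1)] w[OF ij(2)] ij(3) by simp
      then have "w i * p \<le> gcd (m i) (m j)" using pos[OF G(1)] by (intro dvd_imp_le) auto
      then show False using gcd_le[OF G ij(4)] w[OF ij(1)] by linarith
    qed
    moreover have "w ` W \<subseteq> {1..nat \<lfloor>E\<rfloor>}"
    proof
      fix d assume "d \<in> w ` W"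
      then obtain j where j: "j \<in> W" "d = w j" by blast
      have "real d \<le> E" using leE[of d j] w[OF j(1)] j unfolding W_def by blast
      moreover have "d \<noteq> 0" using w[OF j(1)] j(2) by (intro notI) simp
      ultimately show "d \<in> {1..nat \<lfloor>E\<rfloor>}" by (simp add: le_nat_floor)
    qed
    ultimately have "card W \<le> nat \<lfloor>E\<rfloor>" using card_inj_on_le[of w W "{1..nat \<lfloor>E\<rfloor>}"] by simp
    then show "real (card {j\<in>G. p \<in> N j}) \<le> E" using \<open>1 \<le> E\<close> unfolding W_def by linarith
  next
    fix i j P assume ij: "i \<in> G" "j \<in> G" "i \<noteq> j" and P: "P \<subseteq> N i" "P \<subseteq> N j"
    have "finite P" using P(1) finN finite_subset by blast
    have cr: "p \<in> critical_primes D (m i)" "p \<in> critical_primes D (m j)" if "p \<in> P" for p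
      using that P unfolding N_def by auto
    have "\<Prod>P dvd gcd (m i) (m j)"
      using \<open>finite P\<close> critical_primesD[OF cr(1)] critical_primesD[OF cr(2)] by (intro prod_primes_dvd) auto
    then have dv: "\<Prod>P dvd m i" "\<Prod>P \<le> D"
      using gcd_le[OF ij] dvd_imp_le[of "\<Prod>P" "gcd (m i) (m j)"] pos[OF ij(1)] by auto
    have "\<Prod>P * free_part D (m i) \<le> D"
    proof (rule mult_free_part_le[OF pos[OF ij(1)] dv])
      fix q assume q: "prime q" "q dvd \<Prod>P"
      then obtain p where "p \<in> P" "q dvd p" using prime_dvd_prod_iff[OF \<open>finite P\<close> q(1), of "\<lambda>p. p"] by auto
      then have "q = p" using q(1) cr(1) critical_primesD(1) primes_dvd_imp_eq by blast
      then show "q \<in> critical_primes D (m i)" using cr(1) \<open>p \<in> P\<close> by blast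
    qed
    then show "real (\<Prod>P) \<le> E" by (rule leE[OF _ ij(1)])
  next
    fix i j assume ij: "i \<in> G" "j \<in> G" "i \<noteq> j"
    define g where "g = gcd (m i) (m j)"
    have "0 < g" "g \<le> D" unfolding g_def using pos[OF ij(1)] gcd_le[OF ij] by auto
    have gd: "g dvd m i" "g dvd m j" unfolding g_def by auto
    show "N i \<inter> N j \<noteq> {} \<or> N i \<inter> C j \<noteq> {} \<or> C i \<inter> N j \<noteq> {}"
    proof (rule ccontr)
      assume none: "\<not> ?thesis"
      have NC: "p \<in> N h \<or> p \<in> C h" if "prime p" "p dvd g" "h = i \<or> h = j" for p h
      proof -
        have "h \<in> G" "p dvd m h" using that ij gd by auto
        have "p \<le> D" using dvd_imp_le[OF that(2) \<open>0 < g\<close>] \<open>g \<le> D\<close> by linarith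
        show ?thesis
        proof (cases "p \<in> critical_primes D (m h)")
          case True
          then show ?thesis using inN \<open>h \<in> G\<close> \<open>p \<le> D\<close> by blast
        next
          case False
          then have "p dvd free_part D (m h)"
            using \<open>p dvd m h\<close> that(1) primes_dvd_imp_eq by (intro dvd_free_part) auto
          then show ?thesis using that(1) unfolding C_def by blast
        qed
      qed
      have noncrit: "p \<notin> critical_primes D (m h)" if "prime p" "p dvd g" "h = i \<or> h = j" for p h
      proof -
        have "p \<notin> N h" using NC[OF that(1,2), of i] NC[OF that(1,2), of j] none that(3) by blast
        moreover have "h \<in> G" using that ij by auto
        moreover have "p \<le> D" using dvd_imp_le[OF that(2) \<open>0 < g\<close>] \<open>g \<le> D\<close> by linarith
        ultimately show ?thesis using inN by blast
      qed
      have "g dvd free_part D (m i)" "g dvd free_part D (m j)"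
        using gd noncrit by (auto intro!: dvd_free_part)
      then have "[x = a i] (mod int g)" "[x = a j] (mod int g)"
        using x[OF ij(1)] x[OF ij(2)] by (auto intro: cong_dvd_modulus)
      then have "[a i = a j] (mod int g)" by (metis cong_sym cong_trans)
      then show False using ncong[OF ij] unfolding g_def by blast
    qed
  qed
  then show ?thesis unfolding E_def .
qed

section \<open>Moduli with many prime divisors\<close>

text \<open>
  A product of \<open>r\<close> primes from \<open>[Y, 2 Y)\<close> exceeds \<open>D\<close>, so each \<open>r\<close>-element set of such primes belongs to
  at most one modulus.
\<close>
lemma dyadic_dense_bound:
  fixes m :: "'a \<Rightarrow> nat"
  assumes fin: "finite J" and pos: "\<And>i. i \<in> J \<Longrightarrow> 0 < m i"
    and gcd_le: "\<And>i j. i \<in> J \<Longrightarrow> j \<in> J \<Longrightarrow> i \<noteq> j \<Longrightarrow> gcd (m i) (m j) \<le> D"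
    and many: "\<And>i. i \<in> J \<Longrightarrow> y \<le> card {p. prime p \<and> p dvd m i \<and> Y \<le> p \<and> p < 2 * Y}"
    and r: "D < Y ^ r" "r \<le> y" "r \<le> Y"
  shows "real (card J) * (real y / real r) ^ r \<le> real Y ^ r"
proof -
  define A where "A i = {p. prime p \<and> p dvd m i \<and> Y \<le> p \<and> p < 2 * Y}" for i
  define F where "F i = {P. P \<subseteq> A i \<and> card P = r}" for i
  have finA: "finite (A i)" for i by (rule finite_subset[of _ "{..2 * Y}"]) (auto simp: A_def)
  have finF: "finite (F i)" for i unfolding F_def by (rule finite_subset[of _ "Pow (A i)"]) (use finA in auto)
  have disj: "F i \<inter> F j = {}" if ij: "i \<in> J" "j \<in> J" "i \<noteq> j" for i j
  proof (rule ccontr)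
    assume "F i \<inter> F j \<noteq> {}"
    then obtain P where P: "P \<subseteq> A i" "P \<subseteq> A j" "card P = r" unfolding F_def by blast
    have "finite P" using P(1) finA finite_subset by blast
    have "\<Prod>P dvd gcd (m i) (m j)"
      using \<open>finite P\<close> P(1,2) by (intro prod_primes_dvd) (auto simp: A_def)
    then have "\<Prod>P \<le> gcd (m i) (m j)" using pos[OF ij(1)] by (intro dvd_imp_le) auto
    moreover have "Y ^ r \<le> \<Prod>P"
      using prod_mono[of P "\<lambda>_. Y" "\<lambda>p. p"] P by (auto simp: A_def)
    ultimately show False using gcd_le[OF ij] r(1) by linarith
  qed
  have "card J * (y choose r) \<le> (\<Sum>i\<in>J. card (F i))"
  proof -
    have "y choose r \<le> card (F i)" if "i \<in> J" for i
      using many[OF that] n_subsets[OF finA[of i], of r] binomial_right_mono[of y "card (A i)" r]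
      unfolding F_def A_def by simp
    then have "(\<Sum>i\<in>J. y choose r) \<le> (\<Sum>i\<in>J. card (F i))" by (rule sum_mono)
    then show ?thesis by simp
  qed
  also have "\<dots> = card (\<Union>i\<in>J. F i)"
    using fin finF disj by (intro card_UN_disjoint[symmetric]) auto
  also have "\<dots> \<le> card {P. P \<subseteq> {Y..<2 * Y} \<and> card P = r}"
  proof (rule card_mono)
    show "finite {P. P \<subseteq> {Y..<2 * Y} \<and> card P = r}"
      by (rule finite_subset[of _ "Pow {Y..<2 * Y}"]) auto
  qed (auto simp: F_def A_def)
  also have "\<dots> = Y choose r" by (simp add: n_subsets)
  also have "\<dots> \<le> Y ^ r" using r(3) by (rule binomial_le_pow)
  finally have "real (card J * (y choose r)) \<le> real (Y ^ r)" by (simp only: of_nat_le_iff)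
  moreover have "(real y / real r) ^ r \<le> real (y choose r)" using r(2) by (rule binomial_ge_n_over_k_pow_k)
  then have "real (card J) * (real y / real r) ^ r \<le> real (card J) * real (y choose r)" by (rule mult_left_mono) simp
  ultimately show ?thesis by simp
qed

text \<open>
  Some dyadic interval \<open>[Y, 2 Y)\<close> carries weight more than \<open>1 / \<Lambda>\<close>, hence at least
  \<open>sqrt Y / \<Lambda>\<close> prime divisors of the modulus. With \<open>Y ^ (r - 1) \<le> D < Y ^ r\<close> the count above gives
  at most \<open>(\<Lambda>\<^sup>2 sqrt Y) ^ r\<close> classes; as \<open>r \<ge> 2\<close> and \<open>\<Lambda>\<^sup>2 \<le> sqrt Y\<close>, this is at most
  \<open>\<Lambda>\<^sup>4 Y ^ (r - 1)\<close>. The cutoff \<open>2 * \<Lambda> ^ 4\<close> is there to ensure \<open>\<Lambda>\<^sup>2 \<le> sqrt Y\<close>.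
\<close>
lemma dense_bound:
  fixes m :: "'a \<Rightarrow> nat"
  assumes fin: "finite J" and pos: "\<And>i. i \<in> J \<Longrightarrow> 0 < m i"
    and gcd_le: "\<And>i j. i \<in> J \<Longrightarrow> j \<in> J \<Longrightarrow> i \<noteq> j \<Longrightarrow> gcd (m i) (m j) \<le> D"
    and D: "0 < D" "D < 2 ^ \<Lambda>"
    and dense: "\<And>i. i \<in> J \<Longrightarrow> 1 < (\<Sum>p | prime p \<and> p dvd m i \<and> 2 * \<Lambda> ^ 4 < p \<and> p \<le> D. 1 / sqrt (real p))"
  shows "real (card J) \<le> real \<Lambda> ^ 5 * real D"
proof -
  have L1: "1 \<le> \<Lambda>" using D by (cases \<Lambda>) auto
  define K where "K l = {j\<in>J. real \<Lambda> ^ 4 \<le> 2 ^ l \<and> 2 ^ l \<le> D \<and>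
      sqrt (2 ^ l) / \<Lambda> \<le> real (card {p. prime p \<and> p dvd m j \<and> 2 ^ l \<le> p \<and> p < 2 * 2 ^ l})}" for l :: nat
  have "J \<subseteq> (\<Union>l<\<Lambda>. K l)"
  proof
    fix j assume j: "j \<in> J"
    define Q where "Q = {p. prime p \<and> p dvd m j \<and> 2 * \<Lambda> ^ 4 < p \<and> p \<le> D}"
    have finQ: "finite Q" unfolding Q_def by (rule finite_subset[of _ "{..D}"]) auto
    have "\<exists>l. 2 ^ l \<le> p \<and> p < 2 ^ (l + 1)" if "p \<in> Q" for p
      using that unfolding Q_def by (intro ex_power_ivl1) auto
    then obtain s where s: "\<And>p. p \<in> Q \<Longrightarrow> 2 ^ s p \<le> p \<and> p < 2 ^ (s p + 1)" by metis
    have sL: "s ` Q \<subseteq> {..<\<Lambda>}"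
    proof
      fix l assume "l \<in> s ` Q"
      then obtain p where p: "p \<in> Q" "l = s p" by blast
      have "p \<le> D" using p(1) unfolding Q_def by simp
      then have "2 ^ l < (2::nat) ^ \<Lambda>" using s[OF p(1)] D(2) unfolding p(2) by linarith
      then show "l \<in> {..<\<Lambda>}" by simp
    qed
    have "\<exists>l<\<Lambda>. 1 / \<Lambda> < (\<Sum>p | p \<in> Q \<and> s p = l. 1 / sqrt (real p))"
    proof (rule ccontr)
      assume "\<not> ?thesis"
      then have "\<And>l. l < \<Lambda> \<Longrightarrow> (\<Sum>p | p \<in> Q \<and> s p = l. 1 / sqrt (real p)) \<le> 1 / \<Lambda>"
        by (meson not_less)
      then have "(\<Sum>l<\<Lambda>. \<Sum>p | p \<in> Q \<and> s p = l. 1 / sqrt (real p)) \<le> (\<Sum>l<\<Lambda>. 1 / \<Lambda>)"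
        by (intro sum_mono) simp
      moreover have "(\<Sum>l<\<Lambda>. \<Sum>p | p \<in> Q \<and> s p = l. 1 / sqrt (real p)) = (\<Sum>p\<in>Q. 1 / sqrt (real p))"
        using sum.group[OF finQ _ sL] by simp
      ultimately show False using dense[OF j] L1 unfolding Q_def by simp
    qed
    then obtain l where l: "l < \<Lambda>" "1 / \<Lambda> < (\<Sum>p | p \<in> Q \<and> s p = l. 1 / sqrt (real p))" by blast
    define R where "R = {p. p \<in> Q \<and> s p = l}"
    have "R \<noteq> {}"
    proof
      assume "R = {}"
      then show False using l(2) unfolding R_def[symmetric] by simp
    qed
    then obtain p0 where p0: "p0 \<in> Q" "s p0 = l" unfolding R_def by blast
    have "2 * \<Lambda> ^ 4 < 2 * 2 ^ l" using s[OF p0(1)] p0 unfolding Q_def by auto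
    then have "\<Lambda> ^ 4 < 2 ^ l" by simp
    then have a: "real \<Lambda> ^ 4 \<le> 2 ^ l" by (metis less_imp_le of_nat_le_iff of_nat_numeral of_nat_power)
    have b: "2 ^ l \<le> D" using s[OF p0(1)] p0 unfolding Q_def by auto
    have "1 / \<Lambda> \<le> (\<Sum>p\<in>R. 1 / sqrt (real p))" using l(2) unfolding R_def by simp
    also have "\<dots> \<le> (\<Sum>p\<in>R. 1 / sqrt (2 ^ l))"
    proof (rule sum_mono)
      fix p assume "p \<in> R"
      then have "2 ^ l \<le> p" using s unfolding R_def by auto
      then have "(2::real) ^ l \<le> real p" by (metis of_nat_le_iff of_nat_numeral of_nat_power)
      then show "1 / sqrt (real p) \<le> 1 / sqrt (2 ^ l)" by (intro frac_le real_sqrt_le_mono) simp_all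
    qed
    also have "\<dots> = card R / sqrt (2 ^ l)" by simp
    finally have "sqrt (2 ^ l) / \<Lambda> \<le> card R" using L1 by (simp add: field_simps)
    moreover have "card R \<le> card {p. prime p \<and> p dvd m j \<and> 2 ^ l \<le> p \<and> p < 2 * 2 ^ l}"
    proof (rule card_mono)
      show "finite {p. prime p \<and> p dvd m j \<and> 2 ^ l \<le> p \<and> p < 2 * 2 ^ l}"
        by (rule finite_subset[of _ "{..2 * 2 ^ l}"]) auto
    qed (use s in \<open>auto simp: R_def Q_def\<close>)
    ultimately have "sqrt (2 ^ l) / \<Lambda> \<le> real (card {p. prime p \<and> p dvd m j \<and> 2 ^ l \<le> p \<and> p < 2 * 2 ^ l})" by linarith
    then show "j \<in> (\<Union>l<\<Lambda>. K l)" unfolding K_def using a b j l(1) by auto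
  qed
  then have "card J \<le> card (\<Union>l<\<Lambda>. K l)" unfolding K_def using fin by (intro card_mono) auto
  also have "\<dots> \<le> (\<Sum>l<\<Lambda>. card (K l))" by (intro card_UN_le) auto
  finally have "real (card J) \<le> (\<Sum>l<\<Lambda>. real (card (K l)))" by (simp flip: of_nat_sum)
  also have "\<dots> \<le> (\<Sum>l<\<Lambda>. real \<Lambda> ^ 4 * D)"
  proof (rule sum_mono)
    fix l assume "l \<in> {..<\<Lambda>}"
    show "real (card (K l)) \<le> real \<Lambda> ^ 4 * D"
    proof (cases "K l = {}")
      case True
      then show ?thesis by simp
    next
      case False
      define Y :: nat where "Y = 2 ^ l"
      have rY: "real Y = 2 ^ l" unfolding Y_def by simp
      have YL: "real \<Lambda> ^ 4 \<le> real Y" and YD: "Y \<le> D" using False unfolding K_def rY Y_def by auto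
      have sq: "(real \<Lambda>)\<^sup>2 \<le> sqrt Y" using YL by (intro real_le_rsqrt) (simp flip: power_mult)
      have "1 \<le> sqrt Y" using sq one_le_power[of "real \<Lambda>" 2] L1 by linarith
      show ?thesis
      proof (cases "2 \<le> Y")
        case False
        \<comment> \<open>This forces \<open>\<Lambda> = 1\<close> and \<open>D = 1\<close>, and then the sum in the hypothesis is empty.\<close>
        have "Y = 1" using \<open>1 \<le> sqrt Y\<close> False by (cases Y) auto
        then have "\<Lambda> = 1" using YL L1 power_mono[of 2 "real \<Lambda>" 4] by (cases "\<Lambda> = 1") auto
        then have "D = 1" using D by simp
        have "card (K l) \<le> 1"
        proof (rule ccontr)
          assume "\<not> ?thesis"
          moreover have "finite (K l)" unfolding K_def using fin by simp
          ultimately obtain i j where ij: "i \<in> K l" "j \<in> K l" "i \<noteq> j" using card_le_Suc0_iff_eq[of "K l"] by auto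
          then have "i \<in> J" unfolding K_def by auto
          have "(\<Sum>p | prime p \<and> p dvd m i \<and> 2 * \<Lambda> ^ 4 < p \<and> p \<le> D. 1 / sqrt (real p)) = 0"
            using \<open>D = 1\<close> \<open>\<Lambda> = 1\<close> by (intro sum.neutral) auto
          then show False using dense[OF \<open>i \<in> J\<close>] by simp
        qed
        then show ?thesis using \<open>\<Lambda> = 1\<close> \<open>D = 1\<close> by simp
      next
        case True
        obtain s where s: "Y ^ s \<le> D" "D < Y ^ (s + 1)" using ex_power_ivl1[OF True, of D] D(1) by auto
        have "s \<noteq> 0" using s(2) YD by (intro notI) simp
        define r where "r = s + 1"
        have "2 ^ s < (2::nat) ^ \<Lambda>" using power_mono[OF True, of s] s(1) D(2) by linarith
        then have rL: "r \<le> \<Lambda>" unfolding r_def by simp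
        define y where "y = nat \<lceil>sqrt Y / \<Lambda>\<rceil>"
        have y: "sqrt Y / \<Lambda> \<le> real y" unfolding y_def by linarith
        have "real \<Lambda> \<le> sqrt Y / \<Lambda>" using sq L1 by (simp add: field_simps power2_eq_square)
        then have ry: "r \<le> y" using rL y by linarith
        have "real \<Lambda> \<le> real \<Lambda> ^ 4" using L1 self_le_power[of "real \<Lambda>" 4] by simp
        then have "r \<le> Y" using YL rL by linarith
        have "real (card (K l)) * (real y / real r) ^ r \<le> real Y ^ r"
        proof (rule dyadic_dense_bound[where m = m and D = D])
          fix i assume "i \<in> K l"
          then show "y \<le> card {p. prime p \<and> p dvd m i \<and> Y \<le> p \<and> p < 2 * Y}"
            unfolding y_def K_def Y_def by (auto simp: nat_le_iff ceiling_le_iff)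
        qed (use fin pos gcd_le s(2) ry \<open>r \<le> Y\<close> in \<open>auto simp: K_def r_def\<close>)
        moreover have "sqrt Y / (real \<Lambda>)\<^sup>2 \<le> real y / real r"
        proof -
          have "sqrt Y / (real \<Lambda>)\<^sup>2 = (sqrt Y / \<Lambda>) / \<Lambda>" by (simp add: power2_eq_square)
          also have "\<dots> \<le> real y / real r" using y rL L1 unfolding r_def by (intro frac_le) auto
          finally show ?thesis .
        qed
        then have "(sqrt Y / (real \<Lambda>)\<^sup>2) ^ r \<le> (real y / real r) ^ r" by (intro power_mono) auto
        ultimately have "real (card (K l)) * (sqrt Y / (real \<Lambda>)\<^sup>2) ^ r \<le> real Y ^ r"
          by (meson mult_left_mono of_nat_0_le_iff order_trans)
        then have "real (card (K l)) \<le> real Y ^ r / (sqrt Y / (real \<Lambda>)\<^sup>2) ^ r"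
          using \<open>1 \<le> sqrt Y\<close> L1 by (subst pos_le_divide_eq) auto
        also have "\<dots> = ((real \<Lambda>)\<^sup>2 * sqrt Y) ^ r"
        proof -
          have "real Y / (sqrt Y / (real \<Lambda>)\<^sup>2) = (real \<Lambda>)\<^sup>2 * sqrt Y"
            using real_sqrt_mult_self[of "real Y"] \<open>1 \<le> sqrt Y\<close> by (simp add: field_simps)
          then show ?thesis by (metis power_divide)
        qed
        also have "\<dots> = ((real \<Lambda>)\<^sup>2 * sqrt Y)\<^sup>2 * ((real \<Lambda>)\<^sup>2 * sqrt Y) ^ (s - 1)"
          using \<open>s \<noteq> 0\<close> unfolding r_def by (simp flip: power_add)
        also have "\<dots> \<le> ((real \<Lambda>)\<^sup>2 * sqrt Y)\<^sup>2 * (sqrt Y * sqrt Y) ^ (s - 1)"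
          using sq by (intro mult_left_mono power_mono mult_right_mono) auto
        also have "\<dots> = real \<Lambda> ^ 4 * (real Y * real Y ^ (s - 1))" by (simp add: power_mult_distrib flip: power_mult)
        also have "\<dots> = real \<Lambda> ^ 4 * real (Y ^ s)" using \<open>s \<noteq> 0\<close> by (cases s) simp_all
        also have "\<dots> \<le> real \<Lambda> ^ 4 * real D" using s(1) by (intro mult_left_mono) simp_all
        finally show ?thesis .
      qed
    qed
  qed
  also have "\<dots> = real \<Lambda> ^ 5 * real D" by (simp add: power_numeral_reduce)
  finally show ?thesis .
qed

section \<open>Averaging over the residue\<close>

lemma card_residues_ge:
  fixes a :: int
  assumes "0 < c" "c dvd M"
  shows "M div c \<le> card {x \<in> {0..<int M}. [x = a] (mod int c)}"
proof -
  define h where "h t = int c * int t + a mod int c" for t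
  have "inj_on h {..<M div c}" using assms(1) unfolding h_def by (auto intro: inj_onI)
  moreover have "h ` {..<M div c} \<subseteq> {x \<in> {0..<int M}. [x = a] (mod int c)}"
  proof
    fix x assume "x \<in> h ` {..<M div c}"
    then obtain t where t: "t < M div c" "x = h t" by blast
    have am: "0 \<le> a mod int c" "a mod int c < int c" using assms(1) by simp_all
    have "M = c * (M div c)" using assms(2) by simp
    moreover have "c * (t + 1) \<le> c * (M div c)" using t(1) by (intro mult_le_mono2) simp
    ultimately have "int c * int t + int c \<le> int M" by (metis distrib_left mult.right_neutral of_nat_add of_nat_le_iff of_nat_mult)
    moreover have "0 \<le> int c * int t" by simp
    ultimately have "0 \<le> x" "x < int M" using am unfolding t(2) h_def by linarith+
    moreover have "[x = a] (mod int c)" unfolding t(2) h_def by (simp add: Cong.cong_def)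
    ultimately show "x \<in> {x \<in> {0..<int M}. [x = a] (mod int c)}" by simp
  qed
  moreover have "finite {x \<in> {0..<int M}. [x = a] (mod int c)}"
    by (rule finite_subset[of _ "{0..<int M}"]) auto
  ultimately show ?thesis using card_inj_on_le by fastforce
qed

text \<open>
  The expected number of classes \<open>a j (mod c j)\<close> that contain a random integer is \<open>(\<Sum>j. 1 / c j)\<close>; the
  integers below the product of all \<open>c j\<close> serve as the sample space.
\<close>
lemma sum_inverse_moduli_le:
  fixes c :: "'a \<Rightarrow> nat" and a :: "'a \<Rightarrow> int" and B :: real
  assumes fin: "finite J" and pos: "\<And>j. j \<in> J \<Longrightarrow> 0 < c j"
    and B: "\<And>x. real (card {j\<in>J. [x = a j] (mod int (c j))}) \<le> B"
  shows "(\<Sum>j\<in>J. 1 / real (c j)) \<le> B"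
proof -
  define M where "M = (\<Prod>j\<in>J. c j)"
  have M: "0 < M" unfolding M_def using pos by (intro prod_pos) auto
  have "real M * (\<Sum>j\<in>J. 1 / real (c j)) = (\<Sum>j\<in>J. real (M div c j))"
    unfolding sum_distrib_left
  proof (rule sum.cong)
    fix j assume "j \<in> J"
    then have "c j dvd M" unfolding M_def using fin by (intro dvd_prodI) auto
    then show "real M * (1 / real (c j)) = real (M div c j)" by (simp add: real_of_nat_div)
  qed simp
  also have "\<dots> \<le> (\<Sum>j\<in>J. real (card {x \<in> {0..<int M}. [x = a j] (mod int (c j))}))"
  proof (rule sum_mono)
    fix j assume "j \<in> J"
    then have "c j dvd M" unfolding M_def using fin by (intro dvd_prodI) auto
    then show "real (M div c j) \<le> real (card {x \<in> {0..<int M}. [x = a j] (mod int (c j))})"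
      using card_residues_ge[OF pos[OF \<open>j \<in> J\<close>]] by simp
  qed
  also have "\<dots> = (\<Sum>x\<in>{0..<int M}. real (card {j\<in>J. [x = a j] (mod int (c j))}))"
    using sum.swap_restrict[of J "{0..<int M}" "\<lambda>_ _. 1::real" "\<lambda>j x. [x = a j] (mod int (c j))"] fin by simp
  also have "\<dots> \<le> (\<Sum>x\<in>{0..<int M}. B)" using B by (intro sum_mono) auto
  also have "\<dots> = real M * B" by simp
  finally show ?thesis using M by simp
qed

section \<open>The number of pairwise disjoint classes\<close>

text \<open>
  The free parts are grouped by dyadic size. In each group, for every \<open>x\<close> few classes contain \<open>x\<close>
  modulo their free parts, and averaging over \<open>x\<close> bounds the sum of the reciprocals of the free parts.
\<close>
lemma sparse_bound:
  fixes m :: "'a \<Rightarrow> nat" and a :: "'a \<Rightarrow> int"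
  assumes fin: "finite J" and pos: "\<And>i. i \<in> J \<Longrightarrow> 0 < m i"
    and gcd_le: "\<And>i j. i \<in> J \<Longrightarrow> j \<in> J \<Longrightarrow> i \<noteq> j \<Longrightarrow> gcd (m i) (m j) \<le> D"
    and ncong: "\<And>i j. i \<in> J \<Longrightarrow> j \<in> J \<Longrightarrow> i \<noteq> j \<Longrightarrow> \<not> [a i = a j] (mod int (gcd (m i) (m j)))"
    and D: "0 < D" "D < 2 ^ \<Lambda>"
    and wt: "\<And>i. i \<in> J \<Longrightarrow> (\<Sum>p | p \<in> critical_primes D (m i) \<and> p \<le> D. 1 / sqrt (real p)) \<le> 1"
  shows "real (card J) \<le> 96 * real \<Lambda> ^ 3 * real D"
proof -
  define f where "f j = free_part D (m j)" for j
  define K where "K l = {j\<in>J. 2 ^ l \<le> f j \<and> f j < 2 ^ (l + 1)}" for l :: nat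
  have "J \<subseteq> (\<Union>l<\<Lambda>. K l)"
  proof
    fix j assume j: "j \<in> J"
    have "1 \<le> f j" unfolding f_def using free_part_pos[OF pos[OF j], of D] by simp
    then obtain l where l: "2 ^ l \<le> f j" "f j < 2 ^ (l + 1)" using ex_power_ivl1[of 2 "f j"] by auto
    have "f j \<le> D" unfolding f_def using free_part_le[OF pos[OF j] D(1)] .
    then have "2 ^ l < (2::nat) ^ \<Lambda>" using l(1) D(2) by linarith
    then have "l < \<Lambda>" by simp
    then show "j \<in> (\<Union>l<\<Lambda>. K l)" using l j unfolding K_def by blast
  qed
  then have "card J \<le> card (\<Union>l<\<Lambda>. K l)" unfolding K_def using fin by (intro card_mono) auto
  also have "\<dots> \<le> (\<Sum>l<\<Lambda>. card (K l))" by (intro card_UN_le) auto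
  finally have "real (card J) \<le> (\<Sum>l<\<Lambda>. real (card (K l)))" by (simp flip: of_nat_sum)
  also have "\<dots> \<le> (\<Sum>l<\<Lambda>. 96 * (real \<Lambda>)\<^sup>2 * D)"
  proof (rule sum_mono)
    fix l assume "l \<in> {..<\<Lambda>}"
    have fK: "finite (K l)" unfolding K_def using fin by simp
    have "(\<Sum>j\<in>K l. 1 / real (f j)) \<le> 48 * (real \<Lambda>)\<^sup>2 * (real D / real (2 ^ l))"
    proof (rule sum_inverse_moduli_le[OF fK])
      fix j assume "j \<in> K l"
      then show "0 < f j" unfolding K_def f_def using free_part_pos pos by blast
    next
      fix x
      show "real (card {j\<in>K l. [x = a j] (mod int (f j))}) \<le> 48 * (real \<Lambda>)\<^sup>2 * (real D / real (2 ^ l))"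
        by (rule fibre_bound[where m = m and a = a and x = x])
          (use fin pos gcd_le ncong D wt in \<open>simp_all add: K_def f_def\<close>)
    qed
    moreover have "(\<Sum>j\<in>K l. 1 / (2 * 2 ^ l)) \<le> (\<Sum>j\<in>K l. 1 / real (f j))"
    proof (rule sum_mono)
      fix j assume j: "j \<in> K l"
      then have "f j < 2 * 2 ^ l" "0 < f j" unfolding K_def f_def using free_part_pos pos by auto
      then have "real (f j) \<le> real (2 * 2 ^ l)" by (simp only: of_nat_le_iff)
      then have "real (f j) \<le> 2 * 2 ^ l" by simp
      then show "1 / (2 * 2 ^ l) \<le> 1 / real (f j)" using \<open>0 < f j\<close> by (intro frac_le) simp_all
    qed
    ultimately have "card (K l) * (1 / (2 * 2 ^ l)) \<le> 48 * (real \<Lambda>)\<^sup>2 * (real D / 2 ^ l)" by simp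
    then show "real (card (K l)) \<le> 96 * (real \<Lambda>)\<^sup>2 * D" by (simp add: field_simps)
  qed
  also have "\<dots> = 96 * real \<Lambda> ^ 3 * real D" by (simp add: power3_eq_cube power2_eq_square)
  finally show ?thesis .
qed

text \<open>
  The main estimate: \<open>D\<close> bounds the pairwise gcds, and noncongruence modulo the gcd is disjointness of
  the classes.
\<close>
lemma card_le_gcd_log_power:
  fixes m :: "'a \<Rightarrow> nat" and a :: "'a \<Rightarrow> int"
  assumes fin: "finite I" and pos: "\<And>i. i \<in> I \<Longrightarrow> 0 < m i"
    and gcd_le: "\<And>i j. i \<in> I \<Longrightarrow> j \<in> I \<Longrightarrow> i \<noteq> j \<Longrightarrow> gcd (m i) (m j) \<le> D"
    and ncong: "\<And>i j. i \<in> I \<Longrightarrow> j \<in> I \<Longrightarrow> i \<noteq> j \<Longrightarrow> \<not> [a i = a j] (mod int (gcd (m i) (m j)))"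
    and D: "0 < D" "D < 2 ^ \<Lambda>"
  shows "real (card I) \<le> 99 * real \<Lambda> ^ 5 * real D"
proof -
  have L1: "1 \<le> \<Lambda>" using D by (cases \<Lambda>) auto
  define L where "L = 2 * \<Lambda> ^ 4"
  \<comment> \<open>With \<open>L\<close> chosen this way the critical primes outside \<open>W\<close> lie in the range summed over in \<open>H\<close>.
    A divisor greater than \<open>D\<close> determines its modulus, so \<open>W\<close> has at most \<open>D * L\<close> elements.\<close>
  define W where "W = {i\<in>I. \<exists>d. d dvd m i \<and> D < d \<and> d \<le> D * L}"
  define H where "H = {i\<in>I. 1 < (\<Sum>p | prime p \<and> p dvd m i \<and> 2 * \<Lambda> ^ 4 < p \<and> p \<le> D. 1 / sqrt (real p))}"
  define J where "J = I - (W \<union> H)"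
  have "\<forall>i\<in>W. \<exists>d. d dvd m i \<and> D < d \<and> d \<le> D * L" unfolding W_def by blast
  then obtain w where w: "\<And>i. i \<in> W \<Longrightarrow> w i dvd m i \<and> D < w i \<and> w i \<le> D * L" by metis
  have "inj_on w W"
  proof (rule inj_onI, rule ccontr)
    fix i j assume ij: "i \<in> W" "j \<in> W" "w i = w j" "i \<noteq> j"
    then have G: "i \<in> I" "j \<in> I" unfolding W_def by auto
    have "w i dvd gcd (m i) (m j)" using w[OF ij(1)] w[OF ij(2)] ij(3) by simp
    then have "w i \<le> gcd (m i) (m j)" using pos[OF G(1)] by (intro dvd_imp_le) auto
    then show False using gcd_le[OF G ij(4)] w[OF ij(1)] by linarith
  qed
  moreover have "w ` W \<subseteq> {1..D * L}" using w by fastforce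
  ultimately have "card W \<le> D * L" using card_inj_on_le[of w W "{1..D * L}"] by simp
  then have "real (card W) \<le> real (D * L)" by (simp only: of_nat_le_iff)
  then have cW: "real (card W) \<le> 2 * real \<Lambda> ^ 4 * D" unfolding L_def by (simp add: mult_ac)
  have cH: "real (card H) \<le> real \<Lambda> ^ 5 * real D"
    by (rule dense_bound[where m = m]) (use fin pos gcd_le D in \<open>auto simp: H_def\<close>)
  have cJ: "real (card J) \<le> 96 * real \<Lambda> ^ 3 * real D"
  proof (rule sparse_bound[where m = m and a = a])
    fix i assume i: "i \<in> J"
    then have "i \<in> I" "i \<notin> W" "i \<notin> H" unfolding J_def by auto
    have "L < p" if "p \<in> critical_primes D (m i)" for p
    proof (rule ccontr)
      assume "\<not> L < p"
      obtain d where d: "d * p dvd m i" "d \<le> D" "D < d * p"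
        using \<open>p \<in> critical_primes D (m i)\<close> unfolding critical_primes_def by blast
      have "d * p \<le> D * L" using d(2) \<open>\<not> L < p\<close> by (intro mult_le_mono) auto
      then show False using d \<open>i \<in> I\<close> \<open>i \<notin> W\<close> unfolding W_def by blast
    qed
    then have "(\<Sum>p | p \<in> critical_primes D (m i) \<and> p \<le> D. 1 / sqrt (real p)) \<le>
        (\<Sum>p | prime p \<and> p dvd m i \<and> 2 * \<Lambda> ^ 4 < p \<and> p \<le> D. 1 / sqrt (real p))"
      using critical_primesD unfolding L_def by (intro sum_mono2) auto
    then show "(\<Sum>p | p \<in> critical_primes D (m i) \<and> p \<le> D. 1 / sqrt (real p)) \<le> 1"
      using \<open>i \<in> I\<close> \<open>i \<notin> H\<close> unfolding H_def by auto
  qed (use fin pos gcd_le ncong D in \<open>auto simp: J_def\<close>)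
  have "I \<subseteq> (W \<union> H) \<union> J" unfolding J_def by blast
  moreover have "finite ((W \<union> H) \<union> J)" unfolding W_def H_def J_def using fin by simp
  ultimately have "card I \<le> card ((W \<union> H) \<union> J)" by (intro card_mono)
  also have "\<dots> \<le> card W + card H + card J"
    using card_Un_le[of "W \<union> H" J] card_Un_le[of W H] by linarith
  finally have "real (card I) \<le> real (card W) + real (card H) + real (card J)" by linarith
  also have "\<dots> \<le> 2 * real \<Lambda> ^ 4 * D + real \<Lambda> ^ 5 * real D + 96 * real \<Lambda> ^ 3 * real D"
    using cW cH cJ by linarith
  also have "\<dots> \<le> 2 * real \<Lambda> ^ 5 * D + real \<Lambda> ^ 5 * real D + 96 * real \<Lambda> ^ 5 * real D"
    using L1 by (intro add_mono mult_right_mono mult_left_mono power_increasing order_refl) auto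
  finally show ?thesis by (simp add: mult_ac)
qed

section \<open>The lower bound for the largest gcd\<close>

lemma residue_classes_intersect:
  assumes "[a = b] (mod int (gcd m n))"
  shows "residue_class a m \<inter> residue_class b n \<noteq> {}"
proof -
  obtain t where t: "a - b = int (gcd m n) * t"
    using assms unfolding cong_iff_dvd_diff by (auto elim: dvdE)
  obtain u v where uv: "u * int m + v * int n = int (gcd m n)"
    using bezout_int[of "int m" "int n"] by auto
  define x where "x = a - u * int m * t"
  have "x - b = (u * int m + v * int n) * t - u * int m * t" using t uv unfolding x_def by simp
  then have "x - b = v * t * int n" by (simp add: algebra_simps)
  then have "[x = b] (mod int n)" unfolding cong_iff_dvd_diff by simp
  moreover have "[x = a] (mod int m)" unfolding cong_iff_dvd_diff x_def by simp
  ultimately show ?thesis unfolding residue_class_def by blast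
qed

lemma log_power_le_exp_sqrt:
  "\<exists>K>0. \<forall>k::nat. 99 * (1 + log 2 (real k)) ^ 5 * exp (- 2 * sqrt (ln (real k) / ln (ln (real k)))) \<le> K"
proof -
  define f where "f k = 99 * (1 + log 2 (real k)) ^ 5 * exp (- 2 * sqrt (ln (real k) / ln (ln (real k))))" for k :: nat
  have "f \<longlonglongrightarrow> 0" unfolding f_def log_def by real_asymp
  then have "Bseq f" using convergent_imp_Bseq convergentI by blast
  then obtain K where K: "0 < K" "\<And>k. norm (f k) \<le> K" by (auto elim: BseqE)
  have "f k \<le> K" for k using K(2)[of k] by simp
  then show ?thesis using K(1) unfolding f_def by blast
qed

theorem theorem1p1:
  shows "\<exists>(c::real) (\<epsilon> :: nat \<Rightarrow> real). c > 0 \<and> \<epsilon> \<longlonglongrightarrow> 0 \<and>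
    (\<forall>(k::nat) (m :: nat \<Rightarrow> nat) (a :: nat \<Rightarrow> int).
      k \<ge> 3 \<longrightarrow>
      (\<forall>i\<in>{1..k}. m i > 0) \<longrightarrow>
      disjoint_family_on (\<lambda>i. residue_class (a i) (m i)) {1..k} \<longrightarrow>
      real (Max {gcd (m i) (m j) | i j. 1 \<le> i \<and> i < j \<and> j \<le> k})
        \<ge> c * real k * exp (- (2 + \<epsilon> k) * sqrt (ln (real k) / ln (ln (real k)))))"
proof -
  obtain K where K: "0 < K"
    "\<And>k::nat. 99 * (1 + log 2 (real k)) ^ 5 * exp (- 2 * sqrt (ln (real k) / ln (ln (real k)))) \<le> K"
    using log_power_le_exp_sqrt by blast
  have main: "real (Max {gcd (m i) (m j) | i j. 1 \<le> i \<and> i < j \<and> j \<le> k})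
      \<ge> min 1 (1 / K) * real k * exp (- 2 * sqrt (ln (real k) / ln (ln (real k))))"
    if k: "3 \<le> k" and pos: "\<forall>i\<in>{1..k}. 0 < m i"
      and disj: "disjoint_family_on (\<lambda>i. residue_class (a i) (m i)) {1..k}"
    for k :: nat and m :: "nat \<Rightarrow> nat" and a :: "nat \<Rightarrow> int"
  proof -
    define S where "S = {gcd (m i) (m j) | i j. 1 \<le> i \<and> i < j \<and> j \<le> k}"
    define D where "D = Max S"
    define e where "e = exp (- 2 * sqrt (ln (real k) / ln (ln (real k))))"
    have "S \<subseteq> (\<lambda>(i, j). gcd (m i) (m j)) ` ({1..k} \<times> {1..k})" unfolding S_def by force
    then have finS: "finite S" by (rule finite_subset) simp
    have gS: "gcd (m i) (m j) \<in> S" if "i \<in> {1..k}" "j \<in> {1..k}" "i \<noteq> j" for i j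
    proof (cases "i < j")
      case True
      then show ?thesis using that unfolding S_def by auto
    next
      case False
      then have "j < i" using that by simp
      then have "gcd (m j) (m i) \<in> S" using that unfolding S_def by auto
      then show ?thesis by (simp add: gcd.commute)
    qed
    have gle: "gcd (m i) (m j) \<le> D" if "i \<in> {1..k}" "j \<in> {1..k}" "i \<noteq> j" for i j
      unfolding D_def using finS gS[OF that] by (rule Max_ge)
    have "0 < gcd (m 1) (m 2)" using pos k by auto
    moreover have "gcd (m 1) (m 2) \<le> D" using k by (intro gle) auto
    ultimately have "0 < D" by linarith
    have "real D \<ge> min 1 (1 / K) * real k * e"
    proof (cases "k \<le> D")
      case True
      \<comment> \<open>As \<open>k \<ge> 3\<close>, the argument of the square root is nonnegative.\<close>
      have "1 \<le> ln (real k)" using k exp_le by (subst ln_ge_iff) auto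
      then have "e \<le> 1" unfolding e_def by simp
      have "min 1 (1 / K) * real k * e \<le> 1 * real k * 1"
        using K(1) \<open>e \<le> 1\<close> by (intro mult_mono) (auto simp: e_def)
      then show ?thesis using True by simp
    next
      case False
      obtain n where n: "2 ^ n \<le> D" "D < 2 ^ (n + 1)" using ex_power_ivl1[of 2 D] \<open>0 < D\<close> by auto
      have "real k = real (card {1..k})" by simp
      also have "\<dots> \<le> 99 * real (n + 1) ^ 5 * real D"
      proof (rule card_le_gcd_log_power[where m = m and a = a])
        fix i j assume ij: "i \<in> {1..k}" "j \<in> {1..k}" "i \<noteq> j"
        have "residue_class (a i) (m i) \<inter> residue_class (a j) (m j) = {}"
          using disj ij unfolding disjoint_family_on_def by blast
        then show "\<not> [a i = a j] (mod int (gcd (m i) (m j)))" using residue_classes_intersect by blast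
      qed (use pos gle n \<open>0 < D\<close> in auto)
      also have "\<dots> \<le> 99 * (1 + log 2 (real k)) ^ 5 * real D"
      proof -
        have "2 ^ n \<le> k" using n(1) False by linarith
        then have "real (2 ^ n) \<le> real k" by (simp only: of_nat_le_iff)
        then have "2 ^ n \<le> real k" by simp
        then have "real n \<le> log 2 (real k)" using k by (subst le_log_iff) (simp_all add: powr_realpow)
        then show ?thesis by (intro mult_right_mono mult_left_mono power_mono) auto
      qed
      finally have "real k * e \<le> 99 * (1 + log 2 (real k)) ^ 5 * real D * e"
        unfolding e_def by (intro mult_right_mono) auto
      also have "\<dots> = (99 * (1 + log 2 (real k)) ^ 5 * e) * real D" by simp
      also have "\<dots> \<le> K * real D" unfolding e_def using K(2) by (intro mult_right_mono) auto
      finally have "1 / K * (real k * e) \<le> real D" using K(1) by (simp add: field_simps)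
      moreover have "min 1 (1 / K) * (real k * e) \<le> 1 / K * (real k * e)"
        unfolding e_def by (intro mult_right_mono) auto
      ultimately show ?thesis by (simp add: mult.assoc)
    qed
    then show ?thesis unfolding D_def S_def e_def .
  qed
  \<comment> \<open>Powers of the logarithm are absorbed by the exponential factor, so the error term can be zero.
    The minimum with 1 covers the case \<open>k \<le> D\<close>.\<close>
  show ?thesis
  proof (intro exI[of _ "min 1 (1 / K)"] exI[of _ "\<lambda>_. 0"] conjI allI impI)
    fix k :: nat and m :: "nat \<Rightarrow> nat" and a :: "nat \<Rightarrow> int"
    assume "3 \<le> k" "\<forall>i\<in>{1..k}. 0 < m i" "disjoint_family_on (\<lambda>i. residue_class (a i) (m i)) {1..k}"
    from main[OF this] show "real (Max {gcd (m i) (m j) | i j. 1 \<le> i \<and> i < j \<and> j \<le> k})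
        \<ge> min 1 (1 / K) * real k * exp (- (2 + 0) * sqrt (ln (real k) / ln (ln (real k))))" by simp
  qed (use K(1) in auto)
qed

end
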